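(* Suppose that $T=\begin{bmatrix} V & E\\ 0 & S\end{bmatrix}\in\mathscr S_{\mathcal H_1,\mathcal H_2}$. Let $R=\begin{bmatrix}\tilde V&\tilde E\\0&N\end{bmatrix}\in\mathscr N_{\mathcal K_1,\mathcal K_2}$ be an entrywise extension of $T$ such that $|E|\subseteq|\tilde E|$ and $N$ is a minimal normal extension of $S$. Then the following statements are valid: (i) if $E\neq0$, then $\sigma(T)=\bar{\mathbb D}\cup\sigma(S)$ and $\sigma(R)=\bar{\mathbb D}\cup\sigma(N)$; (ii) if $V$ is not unitary, then $\sigma(R)\subseteq\sigma(T)$; (iii) if $\Omega$ is a connected component of $\rho(R)$ such that $\Omega\cap\sigma(T)\neq\varnothing$, then $\Omega\subseteq\sigma(T)$.
   Context: All Hilbert spaces are complex; $B(\mathcal H)$ is the algebra of bounded linear operators on $\mathcal H$; $|E|=(E^*E)^{1/2}$; $\sigma(\cdot)$ and $\rho(\cdot)$ denote the spectrum and the resolvent set; $\bar{\mathbb D}=\{\lambda\in\mathbb C:|\lambda|\le1\}$. $A\subseteq B$ means that $B$ extends $A$: the space of $A$ is (isometrically) a subspace of that of $B$, and $Ah=Bh$ for all $h$ in the space of $A$. For nonzero Hilbert spaces $\mathcal H_1,\mathcal H_2$, the operator $\begin{bmatrix}V&E\\0&X\end{bmatrix}\in B(\mathcal H_1\oplus\mathcal H_2)$ is a Brownian-type operator if $V^*V=I$, $V^*E=0$ and $XE^*E=E^*EX$. It belongs to $\mathscr S_{\mathcal H_1,\mathcal H_2}$ (resp. $\mathscr N_{\mathcal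 H_1,\mathcal H_2}$) if in addition $X$ is subnormal (resp. normal). $S\in B(\mathcal H)$ is subnormal if $S\subseteq N$ for some normal $N\in B(\mathcal K)$, $\mathcal K\supseteq\mathcal H$ (a normal extension of $S$). The normal extension $N$ is minimal if $\mathcal K$ is the only closed subspace of $\mathcal K$ that contains $\mathcal H$ and reduces $N$. $\begin{bmatrix}\tilde A_{11}&\tilde A_{12}\\ \tilde A_{21}&\tilde A_{22}\end{bmatrix}\in B(\mathcal K_1\oplus\mathcal K_2)$ is an entrywise extension of $\begin{bmatrix}A_{11}&A_{12}\\ A_{21}&A_{22}\end{bmatrix}\in B(\mathcal H_1\oplus\mathcal H_2)$ if $\mathcal H_j\subseteq\mathcal K_j$ and $A_{ij}h_j=\tilde A_{ij}h_j$ for all $h_j\in\mathcal H_j$ and $i,j\in\{1,2\}$. *)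

theory Defs
  imports "HOL-Analysis.Analysis"
begin

section \<open>Complex Hilbert spaces\<close>

text \<open>
  HOL-Analysis only has real inner products. A complex Hilbert space is a complete real inner
  product space with a compatible complex structure: the real inner product is the real part of
  the complex one, so the library norm satisfies
  \<open>(norm x)\<^sup>2 = Re (cinner x x)\<close>, with \<open>cinner x x\<close> real. The inner product is linear in its first
  argument.
\<close>

class chilbert_space = real_inner + complete_space +
  fixes scaleC :: "complex \<Rightarrow> 'a \<Rightarrow> 'a" (infixr "*\<^sub>C" 75)
    and cinner :: "'a \<Rightarrow> 'a \<Rightarrow> complex"
  assumes scaleC_add_right: "a *\<^sub>C (x + y) = a *\<^sub>C x + a *\<^sub>C y"
    and scaleC_add_left: "(a + b) *\<^sub>C x = a *\<^sub>C x + b *\<^sub>C x"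
    and scaleC_scaleC: "a *\<^sub>C (b *\<^sub>C x) = (a * b) *\<^sub>C x"
    and scaleR_scaleC: "r *\<^sub>R x = complex_of_real r *\<^sub>C x"
    and cinner_commute: "cinner x y = cnj (cinner y x)"
    and cinner_add_left: "cinner (x + y) z = cinner x z + cinner y z"
    and cinner_scaleC_left: "cinner (a *\<^sub>C x) y = a * cinner x y"
    and inner_cinner: "inner x y = Re (cinner x y)"

text \<open>The Hilbert space direct sum is the product type; its norm is the library one.\<close>

instantiation prod :: (chilbert_space, chilbert_space) chilbert_space
begin

definition scaleC_prod :: "complex \<Rightarrow> 'a \<times> 'b \<Rightarrow> 'a \<times> 'b"
  where "scaleC_prod c p = (c *\<^sub>C fst p, c *\<^sub>C snd p)"

definition cinner_prod :: "'a \<times> 'b \<Rightarrow> 'a \<times> 'b \<Rightarrow> complex"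
  where "cinner_prod p q = cinner (fst p) (fst q) + cinner (snd p) (snd q)"

instance
proof
  fix a b :: complex and r :: real and x y z :: "'a \<times> 'b"
  show "a *\<^sub>C (x + y) = a *\<^sub>C x + a *\<^sub>C y"
    by (simp add: scaleC_prod_def scaleC_add_right)
  show "(a + b) *\<^sub>C x = a *\<^sub>C x + b *\<^sub>C x"
    by (simp add: scaleC_prod_def scaleC_add_left)
  show "a *\<^sub>C (b *\<^sub>C x) = (a * b) *\<^sub>C x"
    by (simp add: scaleC_prod_def scaleC_scaleC)
  show "r *\<^sub>R x = complex_of_real r *\<^sub>C x"
    by (simp add: scaleC_prod_def scaleR_prod_def scaleR_scaleC)
  show "cinner x y = cnj (cinner y x)"
    using cinner_commute[of "fst x" "fst y"] cinner_commute[of "snd x" "snd y"]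
    by (simp add: cinner_prod_def)
  show "cinner (x + y) z = cinner x z + cinner y z"
    by (simp add: cinner_prod_def cinner_add_left)
  show "cinner (a *\<^sub>C x) y = a * cinner x y"
    by (simp add: cinner_prod_def scaleC_prod_def cinner_scaleC_left algebra_simps)
  show "inner x y = Re (cinner x y)"
    by (simp add: cinner_prod_def inner_prod_def inner_cinner)
qed

end

section \<open>Bounded operators\<close>

definition bounded_clinear :: "('a::chilbert_space \<Rightarrow> 'b::chilbert_space) \<Rightarrow> bool"
  where "bounded_clinear A \<longleftrightarrow> bounded_linear A \<and> (\<forall>c x. A (c *\<^sub>C x) = c *\<^sub>C A x)"

definition cadjoint :: "('a::chilbert_space \<Rightarrow> 'b::chilbert_space) \<Rightarrow> 'b \<Rightarrow> 'a"
  where "cadjoint A = (THE B. \<forall>x y. cinner (A x) y = cinner x (B y))"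

definition normal_op :: "('a::chilbert_space \<Rightarrow> 'a) \<Rightarrow> bool"
  where "normal_op N \<longleftrightarrow> bounded_clinear N \<and> cadjoint N \<circ> N = N \<circ> cadjoint N"

definition unitary_op :: "('a::chilbert_space \<Rightarrow> 'a) \<Rightarrow> bool"
  where "unitary_op U \<longleftrightarrow> bounded_clinear U \<and> cadjoint U \<circ> U = id \<and> U \<circ> cadjoint U = id"

definition positive_op :: "('a::chilbert_space \<Rightarrow> 'a) \<Rightarrow> bool"
  where "positive_op P \<longleftrightarrow> bounded_clinear P \<and> (\<forall>x. cinner (P x) x \<in> \<real>\<^sub>\<ge>\<^sub>0)"

definition op_abs :: "('a::chilbert_space \<Rightarrow> 'b::chilbert_space) \<Rightarrow> 'a \<Rightarrow> 'a"
  where "op_abs E = (THE P. positive_op P \<and> P \<circ> P = cadjoint E \<circ> E)"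

definition resolvent_set :: "('a::chilbert_space \<Rightarrow> 'a) \<Rightarrow> complex set"
  where "resolvent_set A =
    {z. \<exists>B. bounded_clinear B \<and> (\<lambda>x. A x - z *\<^sub>C x) \<circ> B = id \<and> B \<circ> (\<lambda>x. A x - z *\<^sub>C x) = id}"

definition spectrum :: "('a::chilbert_space \<Rightarrow> 'a) \<Rightarrow> complex set"
  where "spectrum A = - resolvent_set A"

section \<open>Extensions and subnormality\<close>

text \<open>
  The inclusion of a Hilbert space in a larger one is an isometric linear embedding \<open>J\<close>
  between the two types.
\<close>

definition isometric_embedding :: "('a::chilbert_space \<Rightarrow> 'b::chilbert_space) \<Rightarrow> bool"
  where "isometric_embedding J \<longleftrightarrow> bounded_clinear J \<and> (\<forall>x. norm (J x) = norm x)"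

definition op_extends ::
    "('a::chilbert_space \<Rightarrow> 'b::chilbert_space) \<Rightarrow> ('a \<Rightarrow> 'a) \<Rightarrow> ('b \<Rightarrow> 'b) \<Rightarrow> bool"
  where "op_extends J A B \<longleftrightarrow> isometric_embedding J \<and> (\<forall>h. B (J h) = J (A h))"

definition normal_extension ::
    "('a::chilbert_space \<Rightarrow> 'b::chilbert_space) \<Rightarrow> ('a \<Rightarrow> 'a) \<Rightarrow> ('b \<Rightarrow> 'b) \<Rightarrow> bool"
  where "normal_extension J S N \<longleftrightarrow> normal_op N \<and> op_extends J S N"

text \<open>
  HOL cannot quantify over types inside a formula, so the type \<open>'m\<close> of the space that carries a
  normal extension is a parameter. A theorem with the assumption \<open>subnormal TYPE('m) S\<close>, where the
  type variable \<open>'m\<close> occurs nowhere else, holds as soon as \<open>S\<close> has a normal extension on any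
  complex Hilbert space whatsoever.
\<close>

definition subnormal :: "'m::chilbert_space itself \<Rightarrow> ('a::chilbert_space \<Rightarrow> 'a) \<Rightarrow> bool"
  where "subnormal _ S \<longleftrightarrow>
    bounded_clinear S \<and> (\<exists>(J :: 'a \<Rightarrow> 'm) N. normal_extension J S N)"

definition csubspace :: "'a::chilbert_space set \<Rightarrow> bool"
  where "csubspace M \<longleftrightarrow> subspace M \<and> (\<forall>c. \<forall>x\<in>M. c *\<^sub>C x \<in> M)"

definition corthogonal :: "'a::chilbert_space set \<Rightarrow> 'a set"
  where "corthogonal M = {x. \<forall>y\<in>M. cinner x y = 0}"

definition reduces :: "'a::chilbert_space set \<Rightarrow> ('a \<Rightarrow> 'a) \<Rightarrow> bool"
  where "reduces M A \<longleftrightarrow> A ` M \<subseteq> M \<and> A ` corthogonal M \<subseteq> corthogonal M"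

definition minimal_normal_extension ::
    "('a::chilbert_space \<Rightarrow> 'b::chilbert_space) \<Rightarrow> ('a \<Rightarrow> 'a) \<Rightarrow> ('b \<Rightarrow> 'b) \<Rightarrow> bool"
  where "minimal_normal_extension J S N \<longleftrightarrow> normal_extension J S N \<and>
    (\<forall>M. csubspace M \<and> closed M \<and> range J \<subseteq> M \<and> reduces M N \<longrightarrow> M = UNIV)"

section \<open>Operator matrices\<close>

definition block_op ::
    "('a::chilbert_space \<Rightarrow> 'a) \<Rightarrow> ('b::chilbert_space \<Rightarrow> 'a) \<Rightarrow> ('a \<Rightarrow> 'b) \<Rightarrow> ('b \<Rightarrow> 'b)
      \<Rightarrow> 'a \<times> 'b \<Rightarrow> 'a \<times> 'b"
  where "block_op A11 A12 A21 A22 =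
    (\<lambda>(x, y). (A11 x + A12 y, A21 x + A22 y))"

text \<open>
  The three classes below are predicates on the entries of
  \<open>block_op V E (\<lambda>_. 0) X\<close>; bounded linear entries are determined by the matrix operator.
\<close>

definition brownian_type ::
    "('a::chilbert_space \<Rightarrow> 'a) \<Rightarrow> ('b::chilbert_space \<Rightarrow> 'a) \<Rightarrow> ('b \<Rightarrow> 'b) \<Rightarrow> bool"
  where "brownian_type V E X \<longleftrightarrow>
    (\<exists>x::'a. x \<noteq> 0) \<and> (\<exists>y::'b. y \<noteq> 0) \<and>
    bounded_clinear V \<and> bounded_clinear E \<and> bounded_clinear X \<and>
    cadjoint V \<circ> V = id \<and> cadjoint V \<circ> E = (\<lambda>_. 0) \<and>
    X \<circ> cadjoint E \<circ> E = cadjoint E \<circ> E \<circ> X"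

definition brownian_subnormal ::
    "'m::chilbert_space itself \<Rightarrow>
      ('a::chilbert_space \<Rightarrow> 'a) \<Rightarrow> ('b::chilbert_space \<Rightarrow> 'a) \<Rightarrow> ('b \<Rightarrow> 'b) \<Rightarrow> bool"
  where "brownian_subnormal m V E X \<longleftrightarrow> brownian_type V E X \<and> subnormal m X"

definition brownian_normal ::
    "('a::chilbert_space \<Rightarrow> 'a) \<Rightarrow> ('b::chilbert_space \<Rightarrow> 'a) \<Rightarrow> ('b \<Rightarrow> 'b) \<Rightarrow> bool"
  where "brownian_normal V E X \<longleftrightarrow> brownian_type V E X \<and> normal_op X"

text \<open>\<open>J1\<close> and \<open>J2\<close> include the two summands; the matrix \<open>B\<close> extends the matrix \<open>A\<close>.\<close>

definition entrywise_extension ::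
    "('a::chilbert_space \<Rightarrow> 'c::chilbert_space) \<Rightarrow> ('b::chilbert_space \<Rightarrow> 'd::chilbert_space) \<Rightarrow>
     ('a \<Rightarrow> 'a) \<Rightarrow> ('b \<Rightarrow> 'a) \<Rightarrow> ('a \<Rightarrow> 'b) \<Rightarrow> ('b \<Rightarrow> 'b) \<Rightarrow>
     ('c \<Rightarrow> 'c) \<Rightarrow> ('d \<Rightarrow> 'c) \<Rightarrow> ('c \<Rightarrow> 'd) \<Rightarrow> ('d \<Rightarrow> 'd) \<Rightarrow> bool"
  where "entrywise_extension J1 J2 A11 A12 A21 A22 B11 B12 B21 B22 \<longleftrightarrow>
    isometric_embedding J1 \<and> isometric_embedding J2 \<and>
    (\<forall>h. B11 (J1 h) = J1 (A11 h)) \<and> (\<forall>h. B12 (J2 h) = J1 (A12 h)) \<and>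
    (\<forall>h. B21 (J1 h) = J2 (A21 h)) \<and> (\<forall>h. B22 (J2 h) = J2 (A22 h))"

end

theory Submission
  imports Defs
begin

text \<open>
  An operator triangular in the decomposition \<open>H1 \<times> H2\<close> with hyponormal lower corner has as spectrum
  the union of the spectra of its diagonal entries, because a surjective hyponormal operator is
  injective. A non-unitary isometry \<open>V\<close> has spectrum the closed disc: for \<open>|z| < 1\<close> the
  factorisation \<open>V - z = (I - z V\<^sup>*) V\<close> makes \<open>V\<close> surjective as soon as \<open>V - z\<close> is. This gives (i) and
  reduces (ii) to the inclusion \<open>\<sigma>(N) \<subseteq> \<sigma>(S)\<close>, which is obtained without spectral measures: if \<open>S\<close> is
  invertible, the vectors \<open>g\<close> that admit backward orbits under \<open>N\<close> of growth \<open>\<parallel>S\<^sup>-\<^sup>1\<parallel>\<^sup>n\<close> are dense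
  by minimality, and log-convexity of \<open>n \<mapsto> \<parallel>N\<^sup>n g\<parallel>\<close> makes \<open>N\<close> bounded below on them. Finally (iii)
  holds for every operator \<open>R\<close> extending an operator \<open>T\<close>: by the lower bounds inherited from \<open>R\<close>,
  \<open>\<rho>(T) \<inter> \<rho>(R)\<close> is open and closed in \<open>\<rho>(R)\<close>.
\<close>

section \<open>Complex Hilbert spaces\<close>

lemma scaleC_one [simp]: "1 *\<^sub>C x = (x::'a::chilbert_space)"
  using scaleR_scaleC[of 1 x] by simp

lemma scaleC_zero_right [simp]: "a *\<^sub>C 0 = (0::'a::chilbert_space)"
  using scaleC_add_right[of a "0::'a" 0] by simp

lemma scaleC_minus_right: "a *\<^sub>C (- x) = - (a *\<^sub>C (x::'a::chilbert_space))"
  using scaleC_add_right[of a x "- x"] by (simp add: eq_neg_iff_add_eq_0 add.commute)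

lemma scaleC_diff_right: "a *\<^sub>C (x - y) = a *\<^sub>C x - a *\<^sub>C (y::'a::chilbert_space)"
  using scaleC_add_right[of a x "- y"] by (simp add: scaleC_minus_right)

lemma scaleC_diff_left: "(a - b) *\<^sub>C x = a *\<^sub>C x - b *\<^sub>C (x::'a::chilbert_space)"
  using scaleC_add_left[of "a - b" b x] by (simp add: algebra_simps)

lemma cinner_add_right: "cinner x (y + z) = cinner x y + cinner x (z::'a::chilbert_space)"
  using cinner_commute[of x "y + z"] cinner_commute[of x y] cinner_commute[of x z]
  by (simp add: cinner_add_left)

lemma cinner_scaleC_right: "cinner x (a *\<^sub>C y) = cnj a * cinner x (y::'a::chilbert_space)"
  using cinner_commute[of x "a *\<^sub>C y"] cinner_commute[of x y]
  by (simp add: cinner_scaleC_left)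

lemma cinner_diff_left: "cinner (x - y) z = cinner x z - cinner y (z::'a::chilbert_space)"
  using cinner_add_left[of "x - y" y z] by simp

lemma cinner_diff_right: "cinner x (y - z) = cinner x y - cinner x (z::'a::chilbert_space)"
  using cinner_add_right[of x "y - z" z] by simp

lemma cinner_zero_left [simp]: "cinner 0 (y::'a::chilbert_space) = 0"
  using cinner_diff_left[of "0::'a" 0 y] by simp

lemma cinner_zero_right [simp]: "cinner (x::'a::chilbert_space) 0 = 0"
  using cinner_diff_right[of x 0 0] by simp

lemma cinner_self: "cinner x x = complex_of_real ((norm (x::'a::chilbert_space))\<^sup>2)"
proof (rule complex_eqI)
  show "Re (cinner x x) = Re (complex_of_real ((norm x)\<^sup>2))"
    by (simp add: inner_cinner[symmetric] dot_square_norm)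
  have "Im (cinner x x) = - Im (cinner x x)"
    by (subst cinner_commute) simp
  then show "Im (cinner x x) = Im (complex_of_real ((norm x)\<^sup>2))"
    by simp
qed

lemma cinner_self_eq_0_iff: "cinner x x = 0 \<longleftrightarrow> x = (0::'a::chilbert_space)"
  by (simp add: cinner_self)

lemma norm_scaleC: "norm (a *\<^sub>C x) = cmod a * norm (x::'a::chilbert_space)"
proof -
  have "complex_of_real ((norm (a *\<^sub>C x))\<^sup>2) = complex_of_real ((cmod a * norm x)\<^sup>2)"
    unfolding cinner_self[symmetric] cinner_scaleC_left cinner_scaleC_right
    using complex_norm_square[of a] by (simp add: cinner_self power_mult_distrib ac_simps)
  then have "(norm (a *\<^sub>C x))\<^sup>2 = (cmod a * norm x)\<^sup>2"
    using of_real_eq_iff by blast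
  then show ?thesis
    by (rule power2_eq_imp_eq) auto
qed

text \<open>Lets complex identities be checked on the real inner product, separately for real and
  imaginary parts.\<close>

lemma Im_cinner: "Im (cinner x y) = - inner (\<i> *\<^sub>C x) (y::'a::chilbert_space)"
  by (simp add: inner_cinner cinner_scaleC_left)

lemma cinner_left_ext:
  assumes "\<And>x. cinner x y = cinner x z"
  shows "y = (z::'a::chilbert_space)"
proof -
  have "cinner (y - z) (y - z) = 0"
    using assms[of "y - z"] by (simp add: cinner_diff_right)
  then show ?thesis
    by (simp add: cinner_self_eq_0_iff)
qed

section \<open>Bounded operators and adjoints\<close>

lemma bounded_clinear_bounded_linear: "bounded_clinear A \<Longrightarrow> bounded_linear A"
  and bounded_clinear_scaleC: "bounded_clinear A \<Longrightarrow> A (c *\<^sub>C x) = c *\<^sub>C A x"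
  by (simp_all add: bounded_clinear_def)

lemma bounded_clinear_add: "bounded_clinear A \<Longrightarrow> A (x + y) = A x + A y"
  and bounded_clinear_diff: "bounded_clinear A \<Longrightarrow> A (x - y) = A x - A y"
  and bounded_clinear_zero: "bounded_clinear A \<Longrightarrow> A 0 = 0"
  by (simp_all add: bounded_clinear_def bounded_linear.linear linear_add linear_diff linear_0)

lemma bounded_clinearI:
  assumes "\<And>x y. A (x + y) = A x + A y" "\<And>c x. A (c *\<^sub>C x) = c *\<^sub>C A x"
    and "\<And>x. norm (A x) \<le> norm x * K"
  shows "bounded_clinear A"
  unfolding bounded_clinear_def
  by (intro conjI bounded_linear_intro[of A K] allI)
    (use assms in \<open>auto simp: scaleR_scaleC\<close>)

lemma bounded_clinear_pos_bounded:
  assumes "bounded_clinear A"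
  obtains K where "K > 0" "\<And>x. norm (A x) \<le> K * norm x"
  using bounded_linear.pos_bounded[OF bounded_clinear_bounded_linear[OF assms]]
  by (metis mult.commute)

lemma bounded_clinear_shift:
  assumes "bounded_clinear A"
  shows "bounded_clinear (\<lambda>x. A x - z *\<^sub>C x)"
proof -
  obtain K where K: "K > 0" "\<And>x. norm (A x) \<le> K * norm x"
    using bounded_clinear_pos_bounded[OF assms] by blast
  show ?thesis
  proof (rule bounded_clinearI[where K = "K + cmod z"])
    show "norm (A x - z *\<^sub>C x) \<le> norm x * (K + cmod z)" for x
      using norm_triangle_ineq4[of "A x" "z *\<^sub>C x"] K(2)[of x]
      by (simp add: norm_scaleC algebra_simps)
  qed (use assms in \<open>simp_all add: bounded_clinear_add bounded_clinear_scaleC scaleC_add_right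
        scaleC_diff_right scaleC_scaleC mult.commute\<close>)
qed

text \<open>The representing vector minimises \<open>\<parallel>x\<parallel>\<^sup>2 - 2 f x\<close>.\<close>

lemma riesz_representation:
  fixes f :: "'a::{real_inner, complete_space} \<Rightarrow> real"
  assumes f: "bounded_linear f"
  obtains u where "\<And>x. f x = inner x u"
proof -
  interpret f: bounded_linear f by fact
  obtain K where K: "\<And>x. \<bar>f x\<bar> \<le> norm x * K"
    using f.bounded by auto
  define \<phi> where "\<phi> x = (norm x)\<^sup>2 - 2 * f x" for x
  define m where "m = Inf (range \<phi>)"
  have lower: "\<phi> x \<ge> - K\<^sup>2" for x
  proof -
    have "(norm x)\<^sup>2 - 2 * (norm x * K) + K\<^sup>2 \<ge> 0"
      using zero_le_power2[of "norm x - K"] by (simp add: power2_diff)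
    then show ?thesis
      using K[of x] unfolding \<phi>_def by linarith
  qed
  have bdd: "bdd_below (range \<phi>)"
    by (rule bdd_belowI[of _ "- K\<^sup>2"]) (use lower in auto)
  have m_le: "m \<le> \<phi> x" for x
    unfolding m_def by (rule cINF_lower[OF bdd]) simp
  have "\<exists>x. \<phi> x < m + inverse (real (Suc n))" for n
  proof -
    have "Inf (range \<phi>) < m + inverse (real (Suc n))"
      unfolding m_def by simp
    then show ?thesis
      using cInf_lessD[of "range \<phi>"] by blast
  qed
  then obtain X where X: "\<And>n. \<phi> (X n) < m + inverse (real (Suc n))"
    by metis
  \<comment> \<open>Parallelogram law for \<open>\<phi>\<close>: the linear terms cancel. As
    \<open>\<phi>\<close> is at least \<open>m\<close> at the midpoint, two nearly minimal points
    are close together, so a minimising sequence is Cauchy.\<close>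
  have par: "(norm (x - y))\<^sup>2 = 2 * \<phi> x + 2 * \<phi> y - 4 * \<phi> ((1/2) *\<^sub>R (x + y))" for x y
    unfolding \<phi>_def f.scaleR f.add power2_norm_eq_inner
    by (simp add: inner_simps inner_commute algebra_simps)
  have "Cauchy X"
  proof (rule CauchyI)
    fix e :: real assume e: "e > 0"
    \<comment> \<open>With tolerance \<open>e\<^sup>2 / 4\<close> the right side of
      \<open>par\<close> stays below \<open>4 * (m + e\<^sup>2 / 4) - 4 * m\<close>, which is
      \<open>e\<^sup>2\<close>.\<close>
    obtain M where M: "inverse (real (Suc M)) < e\<^sup>2 / 4"
      using reals_Archimedean[of "e\<^sup>2 / 4"] e by auto
    have small: "\<phi> (X n) < m + e\<^sup>2 / 4" if "n \<ge> M" for n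
    proof -
      have "inverse (real (Suc n)) \<le> inverse (real (Suc M))"
        using that by simp
      then show ?thesis
        using X[of n] M by linarith
    qed
    have "norm (X i - X j) < e" if "i \<ge> M" "j \<ge> M" for i j
    proof -
      have "(norm (X i - X j))\<^sup>2 < e\<^sup>2"
        unfolding par using small[OF that(1)] small[OF that(2)] m_le[of "(1/2) *\<^sub>R (X i + X j)"]
        by linarith
      then show ?thesis
        using e by (simp add: power_less_imp_less_base)
    qed
    then show "\<exists>M. \<forall>i\<ge>M. \<forall>j\<ge>M. norm (X i - X j) < e"
      by blast
  qed
  then obtain u where u: "X \<longlonglongrightarrow> u"
    using Cauchy_convergent convergent_def by blast
  have "(\<lambda>n. \<phi> (X n)) \<longlonglongrightarrow> \<phi> u"
    unfolding \<phi>_def by (intro tendsto_intros f.tendsto u)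
  moreover have "(\<lambda>n. m + inverse (real (Suc n))) \<longlonglongrightarrow> m"
    using LIMSEQ_inverse_real_of_nat_add by simp
  ultimately have "\<phi> u \<le> m"
    by (rule LIMSEQ_le) (use X less_imp_le in blast)
  then have min: "\<phi> u \<le> \<phi> x" for x
    using m_le[of x] by simp
  have "f v = inner v u" for v
  proof (rule ccontr)
    assume ne: "f v \<noteq> inner v u"
    define d where "d = f v - inner v u"
    \<comment> \<open>The increment of \<open>\<phi>\<close> from \<open>u\<close> to
      \<open>u + t *\<^sub>R v\<close>. Its least value, at \<open>t = d / (norm v)\<^sup>2\<close>,
      is negative unless \<open>d = 0\<close>.\<close>
    have quad: "0 \<le> t\<^sup>2 * (norm v)\<^sup>2 - 2 * t * d" for t
      using min[of "u + t *\<^sub>R v"] unfolding \<phi>_def d_def f.scaleR f.add power2_norm_eq_inner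
      by (simp add: inner_simps inner_commute algebra_simps power2_eq_square)
    have v: "(norm v)\<^sup>2 > 0"
      using ne by (auto simp: f.zero)
    have "d\<^sup>2 / (norm v)\<^sup>2 > 0"
      using ne v by (simp add: d_def)
    moreover have "(d / (norm v)\<^sup>2)\<^sup>2 * (norm v)\<^sup>2 - 2 * (d / (norm v)\<^sup>2) * d = - (d\<^sup>2 / (norm v)\<^sup>2)"
      using v by (simp add: field_simps power2_eq_square)
    ultimately show False
      using quad[of "d / (norm v)\<^sup>2"] by linarith
  qed
  then show thesis
    using that by blast
qed

text \<open>Justifies the definite description in \<open>cadjoint\<close>. Riesz yields an adjoint
  for the real inner product; since \<open>A\<close> commutes with multiplication by
  \<open>\<i>\<close>, the imaginary parts agree as well, and the inner product separates
  vectors.\<close>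

lemma cinner_cadjoint:
  fixes A :: "'a::chilbert_space \<Rightarrow> 'b::chilbert_space"
  assumes A: "bounded_clinear A"
  shows "cinner (A x) y = cinner x (cadjoint A y)"
proof -
  have "\<exists>u. \<forall>x. inner (A x) y = inner x u" for y
    using riesz_representation[of "\<lambda>x. inner (A x) y"]
      bounded_linear_compose[OF bounded_linear_inner_left bounded_clinear_bounded_linear[OF A]]
    by metis
  then obtain B where B: "\<And>x y. inner (A x) y = inner x (B y)"
    by metis
  have B': "cinner (A x) y = cinner x (B y)" for x y
    by (simp add: complex_eq_iff Im_cinner inner_cinner[symmetric] B
        bounded_clinear_scaleC[OF A, symmetric])
  have "cadjoint A = B"
    unfolding cadjoint_def
  proof (rule the_equality)
    fix C assume "\<forall>x y. cinner (A x) y = cinner x (C y)"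
    then have "cinner x (C y) = cinner x (B y)" for x y
      by (simp add: B')
    then show "C = B"
      by (intro ext cinner_left_ext)
  qed (simp add: B')
  then show ?thesis
    by (simp add: B')
qed

lemma cinner_cadjoint_left:
  "bounded_clinear A \<Longrightarrow> cinner (cadjoint A x) y = cinner x (A y)"
  by (metis cinner_cadjoint cinner_commute)

lemma cadjoint_eqI:
  assumes "bounded_clinear A" "\<And>x y. cinner (A x) y = cinner x (B y)"
  shows "cadjoint A = B"
  by (intro ext cinner_left_ext) (simp add: cinner_cadjoint[OF assms(1), symmetric] assms(2))

text \<open>Linearity comes from uniqueness of the representing vector. For the bound, the squared
  norm of \<open>cadjoint A x\<close> is the inner product of \<open>A (cadjoint A x)\<close> with
  \<open>x\<close>; Cauchy-Schwarz applies and one factor cancels.\<close>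

lemma bounded_clinear_cadjoint:
  assumes A: "bounded_clinear A"
  shows "bounded_clinear (cadjoint A)"
proof -
  note adj = cinner_cadjoint[OF A, symmetric]
  obtain K where K: "K > 0" "\<And>x. norm (A x) \<le> K * norm x"
    using bounded_clinear_pos_bounded[OF A] by blast
  show ?thesis
  proof (rule bounded_clinearI[where K = K])
    fix x y :: 'b and c
    show "cadjoint A (x + y) = cadjoint A x + cadjoint A y"
      by (rule cinner_left_ext) (simp add: adj cinner_add_right)
    show "cadjoint A (c *\<^sub>C x) = c *\<^sub>C cadjoint A x"
      by (rule cinner_left_ext) (simp add: adj cinner_scaleC_right)
    have "norm (cadjoint A x) * norm (cadjoint A x) = inner (A (cadjoint A x)) x"
      by (simp add: inner_cinner cinner_cadjoint[OF A] cinner_self power2_eq_square)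
    also have "\<dots> \<le> norm (A (cadjoint A x)) * norm x"
      by (rule norm_cauchy_schwarz)
    also have "\<dots> \<le> norm (cadjoint A x) * (norm x * K)"
      using mult_right_mono[OF K(2)[of "cadjoint A x"], of "norm x"] by (simp add: mult.commute mult.left_commute)
    finally show "norm (cadjoint A x) \<le> norm x * K"
      using K(1) by (cases "cadjoint A x = 0") auto
  qed
qed

lemma cadjoint_shift:
  assumes A: "bounded_clinear A"
  shows "cadjoint (\<lambda>x. A x - z *\<^sub>C x) = (\<lambda>x. cadjoint A x - cnj z *\<^sub>C x)"
  by (rule cadjoint_eqI[OF bounded_clinear_shift[OF A]])
    (simp add: cinner_diff_left cinner_diff_right cinner_scaleC_left cinner_scaleC_right
      cinner_cadjoint[OF A])

section \<open>Normal operators and isometric embeddings\<close>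

lemma normal_op_shift:
  assumes "normal_op N"
  shows "normal_op (\<lambda>x. N x - z *\<^sub>C x)"
proof -
  have N: "bounded_clinear N" and comm: "\<And>x. cadjoint N (N x) = N (cadjoint N x)"
    using assms by (auto simp: normal_op_def fun_eq_iff)
  note N' = bounded_clinear_cadjoint[OF N]
  show ?thesis
    unfolding normal_op_def cadjoint_shift[OF N]
    by (auto simp: bounded_clinear_shift N comm fun_eq_iff bounded_clinear_diff[OF N]
        bounded_clinear_diff[OF N'] bounded_clinear_scaleC[OF N] bounded_clinear_scaleC[OF N']
        scaleC_diff_right scaleC_scaleC mult.commute)
qed

text \<open>Both squared norms are the quadratic form at \<open>x\<close> of the same operator,
  because \<open>N\<close> commutes with its adjoint.\<close>

lemma norm_cadjoint_normal:
  assumes "normal_op N"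
  shows "norm (cadjoint N x) = norm (N x)"
proof -
  have N: "bounded_clinear N" and comm: "\<And>x. cadjoint N (N x) = N (cadjoint N x)"
    using assms by (auto simp: normal_op_def fun_eq_iff)
  have "cinner (cadjoint N x) (cadjoint N x) = cinner (N x) (N x)"
    by (simp add: cinner_cadjoint_left[OF N] comm[symmetric] cinner_cadjoint[OF N])
  then have "(norm (cadjoint N x))\<^sup>2 = (norm (N x))\<^sup>2"
    unfolding cinner_self using of_real_eq_iff by blast
  then show ?thesis
    by (rule power2_eq_imp_eq) auto
qed

text \<open>Polarisation gives the real part; replacing \<open>x\<close> by
  \<open>\<i> *\<^sub>C x\<close> gives the imaginary part.\<close>

lemma cinner_isometric_embedding:
  assumes "isometric_embedding J"
  shows "cinner (J x) (J y) = cinner x y"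
proof -
  have J: "bounded_clinear J" and nJ: "\<And>x. norm (J x) = norm x"
    using assms by (auto simp: isometric_embedding_def)
  have "inner (J x) (J y) = inner x y" for x y
    unfolding dot_norm bounded_clinear_add[OF J, symmetric] nJ ..
  then show ?thesis
    by (intro complex_eqI)
      (simp_all add: Im_cinner inner_cinner[symmetric] bounded_clinear_scaleC[OF J, symmetric])
qed

lemma isometric_embedding_id: "isometric_embedding (\<lambda>x. x)"
  by (auto simp: isometric_embedding_def bounded_clinear_def bounded_linear_ident)

section \<open>Resolvent sets\<close>

text \<open>Splits invertibility into a lower bound, which passes to restrictions and dense limits,
  and surjectivity. The lower bound yields both injectivity and the bound on the inverse.\<close>

lemma resolvent_set_iff:
  assumes A: "bounded_clinear A"
  shows "z \<in> resolvent_set A \<longleftrightarrow>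
    (\<exists>c>0. \<forall>x. c * norm x \<le> norm (A x - z *\<^sub>C x)) \<and> surj (\<lambda>x. A x - z *\<^sub>C x)"
    (is "_ \<longleftrightarrow> ?below \<and> ?surj")
proof
  assume "z \<in> resolvent_set A"
  then obtain B where B: "bounded_clinear B"
    and right: "\<And>y. A (B y) - z *\<^sub>C B y = y" and left: "\<And>x. B (A x - z *\<^sub>C x) = x"
    by (auto simp: resolvent_set_def fun_eq_iff)
  obtain K where K: "K > 0" "\<And>y. norm (B y) \<le> K * norm y"
    using bounded_clinear_pos_bounded[OF B] by blast
  have "inverse K * norm x \<le> norm (A x - z *\<^sub>C x)" for x
    using K(2)[of "A x - z *\<^sub>C x"] K(1) by (simp add: left field_simps)
  moreover have ?surj
    by (rule surjI[where f = B]) (rule right)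
  ultimately show "?below \<and> ?surj"
    using K(1) by (intro conjI exI[of _ "inverse K"]) auto
next
  assume "?below \<and> ?surj"
  then obtain c where c: "c > 0" "\<And>x. c * norm x \<le> norm (A x - z *\<^sub>C x)"
    and surj: ?surj
    by blast
  let ?D = "\<lambda>x. A x - z *\<^sub>C x"
  note D = bounded_clinear_shift[OF A, of z]
  have inj: "inj ?D"
  proof (rule injI)
    fix x y assume "?D x = ?D y"
    then have "?D (x - y) = 0"
      using bounded_clinear_diff[OF D] by simp
    then show "x = y"
      using c(2)[of "x - y"] c(1) by (simp add: mult_le_0_iff)
  qed
  define B where "B = inv ?D"
  have right: "?D (B y) = y" for y
    unfolding B_def by (rule surj_f_inv_f[OF surj])
  have left: "B (?D x) = x" for x
    unfolding B_def by (rule inv_f_f[OF inj])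
  have "bounded_clinear B"
  proof (rule bounded_clinearI[where K = "inverse c"])
    fix x y and a
    show "B (x + y) = B x + B y"
      by (metis left right bounded_clinear_add[OF D])
    show "B (a *\<^sub>C x) = a *\<^sub>C B x"
      by (metis left right bounded_clinear_scaleC[OF D])
    show "norm (B x) \<le> norm x * inverse c"
      using c(2)[of "B x"] c(1) by (simp add: right field_simps)
  qed
  then show "z \<in> resolvent_set A"
    using left right by (auto simp: resolvent_set_def fun_eq_iff)
qed

section \<open>Perturbation of the spectral parameter\<close>

lemma norm_shift_shift_ge:
  assumes "c * norm x \<le> norm (A x - w *\<^sub>C x)"
  shows "(c - cmod (z - w)) * norm x \<le> norm (A x - z *\<^sub>C (x::'a::chilbert_space))"
proof -
  have "A x - w *\<^sub>C x = (A x - z *\<^sub>C x) + (z - w) *\<^sub>C x"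
    by (simp add: scaleC_diff_left)
  then have "norm (A x - w *\<^sub>C x) \<le> norm (A x - z *\<^sub>C x) + cmod (z - w) * norm x"
    using norm_triangle_ineq[of "A x - z *\<^sub>C x" "(z - w) *\<^sub>C x"] by (simp only: norm_scaleC)
  then show ?thesis
    using assms by (simp add: left_diff_distrib)
qed

lemma contraction_fixpoint:
  fixes f :: "'a::complete_space \<Rightarrow> 'a"
  assumes "0 \<le> c" "c < 1" "\<And>x y. dist (f x) (f y) \<le> c * dist x y"
  obtains x where "f x = x"
  using banach_fix_type[of c f] assms by auto

text \<open>The equation \<open>y = A x - z *\<^sub>C x\<close> is the fixed point equation
  \<open>x = B (y + (z - w) *\<^sub>C x)\<close>, where \<open>B\<close> inverts
  \<open>A - w\<close>; it is contractive with factor \<open>cmod (z - w) / c\<close>. The radius is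
  the lower bound \<open>c\<close> itself, which allows the argument to be run backwards from a
  nearby point.\<close>

lemma resolvent_set_perturb:
  assumes A: "bounded_clinear A" and w: "w \<in> resolvent_set A"
    and c: "\<And>x. c * norm x \<le> norm (A x - w *\<^sub>C x)" and z: "cmod (z - w) < c"
  shows "z \<in> resolvent_set A"
proof -
  have c0: "c > 0"
    using z norm_ge_zero[of "z - w"] by linarith
  obtain B where B: "bounded_clinear B"
    and right: "\<And>y. A (B y) - w *\<^sub>C B y = y"
    using w by (auto simp: resolvent_set_def fun_eq_iff)
  have nB: "norm (B y) \<le> inverse c * norm y" for y
    using c[of "B y"] c0 by (simp add: right field_simps)
  have "\<exists>x. y = A x - z *\<^sub>C x" for y
  proof -
    have "dist (B (y + (z - w) *\<^sub>C x)) (B (y + (z - w) *\<^sub>C x')) \<le> (cmod (z - w) / c) * dist x x'"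
      for x x'
      using nB[of "(z - w) *\<^sub>C (x - x')"]
      by (simp add: dist_norm bounded_clinear_diff[OF B, symmetric] scaleC_diff_right
          norm_scaleC[of "z - w" "x - x'", simplified scaleC_diff_right] divide_inverse mult.commute mult.left_commute)
    then obtain x where x: "B (y + (z - w) *\<^sub>C x) = x"
      by (rule contraction_fixpoint[rotated 2]) (use z c0 in auto)
    show ?thesis
      using right[of "y + (z - w) *\<^sub>C x"] unfolding x
      by (intro exI[of _ x]) (simp add: scaleC_diff_left algebra_simps)
  qed
  then have "surj (\<lambda>x. A x - z *\<^sub>C x)"
    by (auto simp: surj_def)
  moreover have "(c - cmod (z - w)) * norm x \<le> norm (A x - z *\<^sub>C x)" for x
    by (rule norm_shift_shift_ge[OF c])
  ultimately show ?thesis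
    using z unfolding resolvent_set_iff[OF A] by (auto intro!: exI[of _ "c - cmod (z - w)"])
qed

lemma open_resolvent_set:
  assumes A: "bounded_clinear A"
  shows "open (resolvent_set A)"
  unfolding open_dist
proof
  fix w assume w: "w \<in> resolvent_set A"
  then obtain c where "c > 0" "\<And>x. c * norm x \<le> norm (A x - w *\<^sub>C x)"
    unfolding resolvent_set_iff[OF A] by blast
  then show "\<exists>e>0. \<forall>z. dist z w < e \<longrightarrow> z \<in> resolvent_set A"
    using resolvent_set_perturb[OF A w] by (auto simp: dist_norm)
qed

lemma component_resolvent_extension:
  assumes A: "bounded_clinear A" and B: "bounded_clinear B" and ext: "op_extends J A B"
    and \<Omega>: "\<Omega> \<in> components (resolvent_set B)" and meet: "\<Omega> \<inter> spectrum A \<noteq> {}"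
  shows "\<Omega> \<subseteq> spectrum A"
proof -
  have J: "bounded_clinear J" "\<And>x. norm (J x) = norm x" "\<And>x. B (J x) = J (A x)"
    using ext by (auto simp: op_extends_def isometric_embedding_def)
  have sub: "\<Omega> \<subseteq> resolvent_set B" and conn: "connected \<Omega>"
    using \<Omega> in_components_subset in_components_connected by blast+
  have opn: "open \<Omega>"
    using \<Omega> open_components open_resolvent_set[OF B] by blast
  have op1: "open (\<Omega> \<inter> resolvent_set A)"
    using opn open_resolvent_set[OF A] by blast
  have "open (\<Omega> - resolvent_set A)"
    unfolding open_dist
  proof
    fix z assume z: "z \<in> \<Omega> - resolvent_set A"
    then obtain c where c: "c > 0" "\<And>x. c * norm x \<le> norm (B x - z *\<^sub>C x)"
      using sub resolvent_set_iff[OF B] by blast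
    have cA: "c * norm x \<le> norm (A x - z *\<^sub>C x)" for x
    proof -
      have "norm (A x - z *\<^sub>C x) = norm (B (J x) - z *\<^sub>C J x)"
        by (simp add: J bounded_clinear_scaleC[OF J(1), symmetric]
            bounded_clinear_diff[OF J(1), symmetric])
      then show ?thesis
        using c(2)[of "J x"] by (simp add: J(2))
    qed
    obtain e where e: "e > 0" "\<And>w. dist w z < e \<Longrightarrow> w \<in> \<Omega>"
      using opn z by (auto simp: open_dist)
    \<comment> \<open>At distance below \<open>c / 2\<close> the lower bound at \<open>w\<close>
      still exceeds the distance to \<open>z\<close>. If \<open>w\<close> were in the resolvent set
      of \<open>A\<close>, perturbation from \<open>w\<close> would therefore reach
      \<open>z\<close>.\<close>
    have "w \<in> \<Omega> - resolvent_set A" if w: "dist w z < min e (c / 2)" for w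
    proof -
      have "w \<notin> resolvent_set A"
      proof
        assume "w \<in> resolvent_set A"
        moreover have "(c - cmod (w - z)) * norm x \<le> norm (A x - w *\<^sub>C x)" for x
          by (rule norm_shift_shift_ge[OF cA])
        moreover have "cmod (z - w) < c - cmod (w - z)"
          using w by (simp add: dist_norm norm_minus_commute)
        ultimately have "z \<in> resolvent_set A"
          using resolvent_set_perturb[OF A] by blast
        then show False
          using z by blast
      qed
      then show ?thesis
        using e w by auto
    qed
    then show "\<exists>e>0. \<forall>w. dist w z < e \<longrightarrow> w \<in> \<Omega> - resolvent_set A"
      using e(1) c(1) by (intro exI[of _ "min e (c / 2)"]) auto
  qed
  then have "\<Omega> \<inter> resolvent_set A = {} \<or> \<Omega> - resolvent_set A = {}"
    using connectedD[OF conn op1] by blast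
  then show ?thesis
    using meet by (auto simp: spectrum_def)
qed

section \<open>Triangular operators with hyponormal corner\<close>

text \<open>An eigenvector of a normal operator is an eigenvector of the adjoint for the conjugate
  eigenvalue. Hence \<open>h\<close> is orthogonal to the range of \<open>S - z\<close>, which
  contains \<open>h\<close> by surjectivity.\<close>

lemma inj_shift_of_surj:
  assumes ext: "normal_extension J S N" and surj: "surj (\<lambda>x. S x - z *\<^sub>C x)"
    and h: "S h = z *\<^sub>C h"
  shows "h = 0"
proof -
  have J: "isometric_embedding J" and JS: "\<And>x. N (J x) = J (S x)" and N: "bounded_clinear N"
    and Jlin: "bounded_clinear J" and normal: "normal_op N"
    using ext by (auto simp: normal_extension_def op_extends_def isometric_embedding_def normal_op_def)
  have "norm (cadjoint (\<lambda>x. N x - z *\<^sub>C x) (J h)) = 0"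
    unfolding norm_cadjoint_normal[OF normal_op_shift[OF normal]]
    by (simp add: JS h bounded_clinear_scaleC[OF Jlin])
  then have zero: "cadjoint (\<lambda>x. N x - z *\<^sub>C x) (J h) = 0"
    by simp
  obtain g where g: "h = S g - z *\<^sub>C g"
    using surj by (meson surjD)
  have "cinner h h = cinner (J (S g - z *\<^sub>C g)) (J h)"
    unfolding cinner_isometric_embedding[OF J] using g by simp
  also have "\<dots> = cinner (N (J g) - z *\<^sub>C J g) (J h)"
    by (simp add: JS bounded_clinear_diff[OF Jlin] bounded_clinear_scaleC[OF Jlin])
  also have "\<dots> = 0"
    using cinner_cadjoint[OF bounded_clinear_shift[OF N, of z], of "J g" "J h"] by (simp add: zero)
  finally show ?thesis
    by (simp add: cinner_self_eq_0_iff)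
qed

lemma bounded_clinear_block_upper:
  fixes V :: "'a::chilbert_space \<Rightarrow> 'a" and E :: "'b::chilbert_space \<Rightarrow> 'a" and S :: "'b \<Rightarrow> 'b"
  assumes V: "bounded_clinear V" and E: "bounded_clinear E" and S: "bounded_clinear S"
  shows "bounded_clinear (block_op V E (\<lambda>_. 0) S)"
proof -
  have V1: "bounded_linear (\<lambda>p :: 'a \<times> 'b. V (fst p))"
    by (rule bounded_linear_compose[OF bounded_clinear_bounded_linear[OF V] bounded_linear_fst])
  have E2: "bounded_linear (\<lambda>p :: 'a \<times> 'b. E (snd p))"
    by (rule bounded_linear_compose[OF bounded_clinear_bounded_linear[OF E] bounded_linear_snd])
  have S2: "bounded_linear (\<lambda>p :: 'a \<times> 'b. S (snd p))"
    by (rule bounded_linear_compose[OF bounded_clinear_bounded_linear[OF S] bounded_linear_snd])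
  have "bounded_linear (\<lambda>p. (V (fst p) + E (snd p), S (snd p)))"
    by (rule bounded_linear_Pair[OF bounded_linear_add[OF V1 E2] S2])
  moreover have "block_op V E (\<lambda>_. 0) S = (\<lambda>p. (V (fst p) + E (snd p), S (snd p)))"
    by (auto simp: block_op_def)
  ultimately show ?thesis
    by (auto simp: bounded_clinear_def scaleC_prod_def scaleC_add_right
        bounded_clinear_scaleC[OF V] bounded_clinear_scaleC[OF E] bounded_clinear_scaleC[OF S])
qed

text \<open>An invertible triangular matrix need not have invertible diagonal entries. Here the
  second row makes \<open>S - z\<close> surjective, subnormality then makes it injective, and this
  decouples the two rows. The converse is back substitution.\<close>

lemma resolvent_set_block_upper:
  assumes V: "bounded_clinear V" and E: "bounded_clinear E" and S: "bounded_clinear S"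
    and ext: "normal_extension J S N"
  shows "resolvent_set (block_op V E (\<lambda>_. 0) S) = resolvent_set V \<inter> resolvent_set S"
proof (intro equalityI subsetI IntI)
  fix z
  define T where "T = block_op V E (\<lambda>_. 0) S"
  have T: "bounded_clinear T"
    unfolding T_def by (rule bounded_clinear_block_upper[OF V E S])
  have Tz: "T (x, h) - z *\<^sub>C (x, h) = (V x - z *\<^sub>C x + E h, S h - z *\<^sub>C h)" for x h
    by (simp add: T_def block_op_def scaleC_prod_def)
  {
    assume "z \<in> resolvent_set (block_op V E (\<lambda>_. 0) S)"
    then obtain c where c: "c > 0" "\<And>p. c * norm p \<le> norm (T p - z *\<^sub>C p)"
      and surj: "\<And>q. \<exists>p. q = T p - z *\<^sub>C p"
      using resolvent_set_iff[OF T] unfolding T_def[symmetric] surj_def by metis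
    have surj': "\<exists>x h. V x - z *\<^sub>C x + E h = y \<and> S h - z *\<^sub>C h = k" for y k
      using surj[of "(y, k)"] Tz by (metis Pair_inject surj_pair)
    have surjS: "surj (\<lambda>x. S x - z *\<^sub>C x)"
      unfolding surj_def using surj' by metis
    have inj: "h = 0" if "S h - z *\<^sub>C h = 0" for h
      using inj_shift_of_surj[OF ext surjS, of h] that by simp
    show "z \<in> resolvent_set V"
      unfolding resolvent_set_iff[OF V]
    proof (intro conjI exI[of _ c] allI c(1))
      show "c * norm x \<le> norm (V x - z *\<^sub>C x)" for x
        using c(2)[of "(x, 0)"] unfolding Tz
        by (simp add: norm_Pair bounded_clinear_zero[OF E] bounded_clinear_zero[OF S])
      \<comment> \<open>A preimage of \<open>(y, 0)\<close> has its second component in the kernel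
        of \<open>S - z\<close>, so that component vanishes.\<close>
      show "surj (\<lambda>x. V x - z *\<^sub>C x)"
        unfolding surj_def using surj'[of _ 0] inj bounded_clinear_zero[OF E]
        by (metis add_0_right)
    qed
    show "z \<in> resolvent_set S"
      unfolding resolvent_set_iff[OF S]
    proof (intro conjI exI[of _ c] allI c(1) surjS)
      fix h
      \<comment> \<open>Taking the target \<open>(0, S h - z *\<^sub>C h)\<close> forces
        \<open>h' = h\<close> and gives an image whose norm comes from the second component
        alone.\<close>
      obtain x h' where x: "V x - z *\<^sub>C x + E h' = 0" and h': "S h' - z *\<^sub>C h' = S h - z *\<^sub>C h"
        using surj' by blast
      have "S (h' - h) - z *\<^sub>C (h' - h) = 0"
        using h' by (simp add: bounded_clinear_diff[OF S] scaleC_diff_right algebra_simps)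
      then have "h' = h"
        using inj by fastforce
      then have "c * norm (x, h) \<le> norm (S h - z *\<^sub>C h)"
        using c(2)[of "(x, h)"] x unfolding Tz by (simp add: norm_Pair)
      moreover have "c * norm h \<le> c * norm (x, h)"
        using c(1) norm_snd_le[of h x] by simp
      ultimately show "c * norm h \<le> norm (S h - z *\<^sub>C h)"
        by linarith
    qed
  }
  assume "z \<in> resolvent_set V \<inter> resolvent_set S"
  then obtain a b where a: "a > 0" "\<And>x. a * norm x \<le> norm (V x - z *\<^sub>C x)"
    and b: "b > 0" "\<And>h. b * norm h \<le> norm (S h - z *\<^sub>C h)"
    and surjV: "\<And>y. \<exists>x. y = V x - z *\<^sub>C x" and surjS: "\<And>k. \<exists>h. k = S h - z *\<^sub>C h"
    unfolding Int_iff resolvent_set_iff[OF V] resolvent_set_iff[OF S] surj_def by blast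
  obtain K where K: "K > 0" "\<And>h. norm (E h) \<le> K * norm h"
    using bounded_clinear_pos_bounded[OF E] by blast
  \<comment> \<open>Back substitution with image norm \<open>r\<close>: \<open>norm h\<close> is at
    most \<open>r / b\<close>, and then \<open>norm x\<close> is at most
    \<open>(r + K * (r / b)) / a\<close>.\<close>
  define C where "C = (1 + K / b) / a + 1 / b"
  have C: "C > 0"
    using a b K by (simp add: C_def add_pos_pos)
  have below: "norm p \<le> C * norm (T p - z *\<^sub>C p)" for p
  proof -
    obtain x h where p: "p = (x, h)"
      by fastforce
    define y k where "y = V x - z *\<^sub>C x + E h" and "k = S h - z *\<^sub>C h"
    define r where "r = norm (y, k)"
    have yr: "norm y \<le> r" and kr: "norm k \<le> r"
      using norm_fst_le[of y k] norm_snd_le[of k y] by (simp_all add: r_def)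
    have hr: "norm h \<le> r / b"
      using b(2)[of h] kr b(1) by (simp add: k_def field_simps)
    have "a * norm x \<le> norm (y - E h)"
      using a(2)[of x] by (simp add: y_def)
    also have "\<dots> \<le> norm y + norm (E h)"
      by (rule norm_triangle_ineq4)
    also have "\<dots> \<le> r + K * (r / b)"
      using yr K(2)[of h] mult_left_mono[OF hr, of K] K(1) by linarith
    finally have xr: "norm x \<le> (r + K * (r / b)) / a"
      using a(1) by (simp add: field_simps)
    have "norm p \<le> norm x + norm h"
      unfolding p by (rule norm_Pair_le)
    also have "\<dots> \<le> (r + K * (r / b)) / a + r / b"
      using xr hr by (rule add_mono)
    also have "\<dots> = C * r"
      using a(1) b(1) by (simp add: C_def field_simps)
    also have "r = norm (T p - z *\<^sub>C p)"
      unfolding r_def p Tz y_def k_def ..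
    finally show ?thesis .
  qed
  have surjT: "\<exists>p. q = T p - z *\<^sub>C p" for q
  proof -
    obtain y k where q: "q = (y, k)"
      by fastforce
    obtain h where h: "k = S h - z *\<^sub>C h"
      using surjS by blast
    obtain x where "y - E h = V x - z *\<^sub>C x"
      using surjV by blast
    then have "q = T (x, h) - z *\<^sub>C (x, h)"
      unfolding Tz q h by (simp add: algebra_simps)
    then show ?thesis
      by blast
  qed
  have "inverse C * norm p \<le> norm (T p - z *\<^sub>C p)" for p
    using below[of p] C by (simp add: field_simps)
  then have "z \<in> resolvent_set T"
    unfolding resolvent_set_iff[OF T] surj_def using C surjT
    by (intro conjI exI[of _ "inverse C"]) auto
  then show "z \<in> resolvent_set (block_op V E (\<lambda>_. 0) S)"
    by (simp add: T_def)
qed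

section \<open>Isometries\<close>

lemma
  assumes V: "bounded_clinear V" and iso: "cadjoint V \<circ> V = id"
  shows norm_isometry: "norm (V x) = norm x"
    and norm_cadjoint_isometry_le: "norm (cadjoint V y) \<le> norm y"
proof -
  have norm: "norm (V x) = norm x" for x
  proof -
    have "cinner (V x) (V x) = cinner x x"
      using iso by (simp add: cinner_cadjoint[OF V] fun_eq_iff)
    then have "(norm (V x))\<^sup>2 = (norm x)\<^sup>2"
      unfolding cinner_self using of_real_eq_iff by blast
    then show ?thesis
      by (rule power2_eq_imp_eq) auto
  qed
  then show "norm (V x) = norm x" .
  have "norm (cadjoint V y) * norm (cadjoint V y) = inner (V (cadjoint V y)) y"
    by (simp add: inner_cinner cinner_cadjoint[OF V] cinner_self power2_eq_square)
  also have "\<dots> \<le> norm (cadjoint V y) * norm y"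
    using norm_cauchy_schwarz[of "V (cadjoint V y)" y] by (simp add: norm)
  finally show "norm (cadjoint V y) \<le> norm y"
    by (cases "cadjoint V y = 0") auto
qed

lemma spectrum_isometry_subset:
  assumes V: "bounded_clinear V" and iso: "cadjoint V \<circ> V = id"
  shows "spectrum V \<subseteq> cball 0 1"
proof -
  have "z \<in> resolvent_set V" if z: "cmod z > 1" for z
    unfolding resolvent_set_iff[OF V]
  proof (intro conjI exI[of _ "cmod z - 1"] allI)
    show "0 < cmod z - 1"
      using z by simp
    show "(cmod z - 1) * norm x \<le> norm (V x - z *\<^sub>C x)" for x
      using norm_triangle_ineq2[of "z *\<^sub>C x" "V x"]
      by (simp add: norm_scaleC norm_isometry[OF V iso] norm_minus_commute left_diff_distrib)
    show "surj (\<lambda>x. V x - z *\<^sub>C x)"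
      unfolding surj_def
    proof
      fix y
      \<comment> \<open>The equation to solve is rewritten as
        \<open>x = inverse z *\<^sub>C (V x - y)\<close>, a contraction outside the closed
        disc.\<close>
      have "dist (inverse z *\<^sub>C (V x - y)) (inverse z *\<^sub>C (V x' - y)) \<le> inverse (cmod z) * dist x x'"
        for x x'
        by (simp add: dist_norm scaleC_diff_right[symmetric] norm_scaleC norm_inverse
            bounded_clinear_diff[OF V, symmetric] norm_isometry[OF V iso])
      then obtain x where x: "inverse z *\<^sub>C (V x - y) = x"
        by (rule contraction_fixpoint[rotated 2]) (use z in \<open>auto simp: inverse_less_1_iff\<close>)
      have "z *\<^sub>C x = z *\<^sub>C (inverse z *\<^sub>C (V x - y))"
        unfolding x ..
      also have "\<dots> = V x - y"
        using right_inverse[of z] z by (cases "z = 0") (simp_all add: scaleC_scaleC)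
      finally have "z *\<^sub>C x = V x - y" .
      then show "\<exists>x. y = V x - z *\<^sub>C x"
        by (intro exI[of _ x]) simp
    qed
  qed
  then show ?thesis
    by (force simp: spectrum_def)
qed

lemma unitary_of_resolvent_disc:
  assumes V: "bounded_clinear V" and iso: "cadjoint V \<circ> V = id"
    and z: "z \<in> resolvent_set V" and "cmod z < 1"
  shows "unitary_op V"
proof -
  note V' = bounded_clinear_cadjoint[OF V]
  have inv: "cadjoint V (V x) = x" for x
    using iso by (simp add: fun_eq_iff)
  have "y \<in> range V" for y
  proof -
    \<comment> \<open>Surjectivity of \<open>V - z\<close> is applied to the image of
      \<open>y\<close> under \<open>I - z V^*\<close>, not to \<open>y\<close>. Since
      \<open>V^* V = I\<close>, the defect \<open>d\<close> is fixed by \<open>z V^*\<close>, which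
      has norm below 1.\<close>
    obtain x where x: "y - z *\<^sub>C cadjoint V y = V x - z *\<^sub>C x"
      using z resolvent_set_iff[OF V, of z] by (meson surjD)
    define d where "d = V x - y"
    have "d = z *\<^sub>C cadjoint V d"
      using x by (simp add: d_def bounded_clinear_diff[OF V'] inv scaleC_diff_right algebra_simps)
    then have "norm d = cmod z * norm (cadjoint V d)"
      by (metis norm_scaleC)
    also have "\<dots> \<le> cmod z * norm d"
      by (intro mult_left_mono norm_cadjoint_isometry_le[OF V iso]) auto
    finally have "(1 - cmod z) * norm d \<le> 0"
      by (simp add: left_diff_distrib)
    then have "d = 0"
      using \<open>cmod z < 1\<close> by (simp add: mult_le_0_iff)
    then have "y = V x"
      by (simp add: d_def)
    then show ?thesis
      by blast
  qed
  then have "V (cadjoint V y) = y" for y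
    by (metis inv rangeE)
  then show ?thesis
    using V iso by (auto simp: unitary_op_def fun_eq_iff)
qed

text \<open>The open disc lies in the spectrum by \<open>unitary_of_resolvent_disc\<close>;
  closedness of the spectrum adds the circle.\<close>

lemma spectrum_nonunitary_isometry:
  assumes V: "bounded_clinear V" and iso: "cadjoint V \<circ> V = id" and "\<not> unitary_op V"
  shows "spectrum V = cball 0 1"
proof
  show "spectrum V \<subseteq> cball 0 1"
    by (rule spectrum_isometry_subset[OF V iso])
  have "ball 0 1 \<subseteq> spectrum V"
    using unitary_of_resolvent_disc[OF V iso] \<open>\<not> unitary_op V\<close> by (auto simp: spectrum_def)
  moreover have "closed (spectrum V)"
    unfolding spectrum_def using open_resolvent_set[OF V] by (simp add: closed_Compl)
  ultimately have "closure (ball 0 1) \<subseteq> spectrum V"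
    by (rule closure_minimal)
  then show "cball 0 1 \<subseteq> spectrum V"
    by simp
qed

text \<open>The range of \<open>E\<close> lies in the kernel of \<open>cadjoint V\<close>, which is
  trivial for unitary \<open>V\<close>.\<close>

lemma brownian_type_unitary_corner:
  assumes "brownian_type V E X" "unitary_op V"
  shows "E = (\<lambda>_. 0)"
proof
  fix h
  have "V (cadjoint V (E h)) = E h" "cadjoint V (E h) = 0" "bounded_clinear V"
    using assms by (auto simp: brownian_type_def unitary_op_def o_def id_def dest: fun_cong)
  then show "E h = 0"
    by (metis bounded_clinear_zero)
qed

section \<open>Spectral inclusion for minimal normal extensions\<close>

text \<open>Log-convexity makes successive ratios nondecreasing, so a first ratio
  \<open>r > q\<close> would force growth at least like \<open>r ^ n\<close>, faster than the
  assumed bound.\<close>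

lemma log_convex_growth:
  fixes b :: "nat \<Rightarrow> real"
  assumes nonneg: "\<And>n. b n \<ge> 0" and conv: "\<And>n. (b (Suc n))\<^sup>2 \<le> b n * b (Suc (Suc n))"
    and growth: "\<And>n. b n \<le> C * q ^ n" and q: "q > 0"
  shows "b 1 \<le> q * b 0"
proof (rule ccontr)
  assume neg: "\<not> ?thesis"
  then have b1: "b 1 > 0"
    using nonneg[of 0] q by (smt (verit) mult_nonneg_nonneg)
  have b0: "b 0 > 0"
    using conv[of 0] b1 nonneg[of 0] by (cases "b 0 = 0") auto
  define r where "r = b 1 / b 0"
  have r: "r > q" "r > 0"
    using neg b0 b1 by (auto simp: r_def field_simps)
  \<comment> \<open>Positivity is carried through the induction because the convexity inequality is
    divided by \<open>b n\<close>.\<close>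
  have step: "b n > 0 \<and> b (Suc n) \<ge> r * b n" for n
  proof (induction n)
    case 0
    then show ?case
      using b0 by (simp add: r_def)
  next
    case (Suc n)
    have pos: "b (Suc n) > 0"
      using Suc r by (smt (verit) mult_pos_pos)
    have "b n * (r * b (Suc n)) \<le> b (Suc n) * b (Suc n)"
      using mult_right_mono[of "r * b n" "b (Suc n)" "b (Suc n)"] Suc pos
      by (simp add: mult.commute mult.left_commute)
    also have "\<dots> \<le> b n * b (Suc (Suc n))"
      using conv[of n] by (simp add: power2_eq_square)
    finally show ?case
      using Suc pos by simp
  qed
  have geo: "b n \<ge> b 0 * r ^ n" for n
  proof (induction n)
    case (Suc n)
    then have "r * (b 0 * r ^ n) \<le> r * b n"
      using r by simp
    then show ?case
      using step[of n] by (simp add: mult.left_commute)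
  qed simp
  have bound: "(r / q) ^ n \<le> C / b 0" for n
    using order_trans[OF geo[of n] growth[of n]] q b0 by (simp add: power_divide field_simps)
  have "1 < r / q"
    using r q by simp
  then obtain n where "C / b 0 < (r / q) ^ n"
    using real_arch_pow by blast
  then show False
    using bound[of n] by simp
qed

text \<open>Log-convexity is \<open>\<parallel>N f\<parallel>\<^sup>2 = \<langle>N\<^sup>* N f, f\<rangle> \<le> \<parallel>N N f\<parallel> \<parallel>f\<parallel>\<close>.\<close>

lemma normal_backward_orbit_bound:
  assumes normal: "normal_op N" and orbit: "\<And>n. N (f (Suc n)) = f n"
    and growth: "\<And>n. norm (f n) \<le> C * q ^ n" and q: "q > 0"
  shows "norm (f 0) \<le> q * norm (N (f 0))"
proof -
  have N: "bounded_clinear N"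
    using normal by (simp add: normal_op_def)
  \<comment> \<open>The norms along the orbit, with the forward image of \<open>f 0\<close>
    prepended: the claim becomes a bound for the first ratio.\<close>
  define b where "b n = (case n of 0 \<Rightarrow> norm (N (f 0)) | Suc m \<Rightarrow> norm (f m))" for n
  have sq: "(norm (N x))\<^sup>2 \<le> norm (N (N x)) * norm x" for x
  proof -
    have "(norm (N x))\<^sup>2 = inner (cadjoint N (N x)) x"
      by (simp add: inner_cinner cinner_cadjoint_left[OF N] cinner_self)
    also have "\<dots> \<le> norm (N (N x)) * norm x"
      using norm_cauchy_schwarz[of "cadjoint N (N x)" x] by (simp add: norm_cadjoint_normal[OF normal])
    finally show ?thesis .
  qed
  have "b 1 \<le> q * b 0"
  proof (rule log_convex_growth[OF _ _ _ q])
    show "b n \<ge> 0" for n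
      by (simp add: b_def split: nat.split)
    show "(b (Suc n))\<^sup>2 \<le> b n * b (Suc (Suc n))" for n
      using sq[of "f (Suc n)"] by (cases n) (simp_all add: b_def orbit)
    \<comment> \<open>The maximum covers the prepended term, and \<open>C / q\<close> compensates
      for the index shift.\<close>
    show "b n \<le> max (norm (N (f 0))) (C / q) * q ^ n" for n
    proof (cases n)
      case (Suc m)
      have "norm (f m) \<le> (C / q) * q ^ n"
        using growth[of m] q Suc by simp
      also have "\<dots> \<le> max (norm (N (f 0))) (C / q) * q ^ n"
        using q by (intro mult_right_mono) auto
      finally show ?thesis
        by (simp add: b_def Suc)
    qed (simp add: b_def)
  qed
  then show ?thesis
    by (simp add: b_def)
qed

text \<open>The positive operator \<open>P = N^* N\<close> is bounded below, so
  \<open>P x = y\<close> is solved by the contractive iteration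
  \<open>x - t *\<^sub>R (P x - y)\<close>. By normality \<open>y\<close> is then also
  \<open>N (cadjoint N x)\<close>.\<close>

lemma normal_bounded_below_surj:
  assumes normal: "normal_op N" and c: "c > 0" "\<And>x. c * norm x \<le> norm (N x)"
  shows "surj N"
proof -
  have N: "bounded_clinear N" and comm: "\<And>x. cadjoint N (N x) = N (cadjoint N x)"
    using normal by (auto simp: normal_op_def fun_eq_iff)
  note N' = bounded_clinear_cadjoint[OF N]
  define P where "P x = cadjoint N (N x)" for x
  obtain K where K: "K > 0" "\<And>x. norm (N x) \<le> K * norm x"
    using bounded_clinear_pos_bounded[OF N] by blast
  have P_diff: "P (x - y) = P x - P y" for x y
    by (simp add: P_def bounded_clinear_diff[OF N] bounded_clinear_diff[OF N'])
  have P_lower: "inner (P x) x \<ge> c\<^sup>2 * (norm x)\<^sup>2" for x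
  proof -
    have "inner (P x) x = (norm (N x))\<^sup>2"
      by (simp add: P_def inner_cinner cinner_cadjoint_left[OF N] cinner_self)
    then show ?thesis
      using power_mono[OF c(2)[of x], of 2] c(1) by (simp add: power_mult_distrib)
  qed
  have P_upper: "(norm (P x))\<^sup>2 \<le> K ^ 4 * (norm x)\<^sup>2" for x
  proof -
    have "norm (P x) \<le> K * norm (N x)"
      unfolding P_def norm_cadjoint_normal[OF normal] by (rule K(2))
    also have "\<dots> \<le> K * (K * norm x)"
      using K by simp
    finally show ?thesis
      using power_mono[of "norm (P x)" "K * (K * norm x)" 2]
      by (simp add: power_mult_distrib power2_eq_square power4_eq_xxxx ac_simps)
  qed
  \<comment> \<open>Besides bounding the square of the norm of \<open>P\<close>, \<open>M\<close>
    dominates \<open>c ^ 4\<close>, which keeps \<open>a\<close> nonnegative even on the zero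
    space.\<close>
  define M where "M = max (K ^ 4) (c ^ 4)"
  have M: "M > 0" "M \<ge> K ^ 4" "M \<ge> c ^ 4"
    using K(1) by (auto simp: M_def less_max_iff_disj)
  \<comment> \<open>This step size minimises the contraction estimate
    \<open>1 - 2 * t * c\<^sup>2 + t\<^sup>2 * M\<close>; the minimum is \<open>a\<close>.\<close>
  define t where "t = c\<^sup>2 / M"
  have t: "t > 0"
    using M c by (simp add: t_def)
  define a where "a = 1 - c ^ 4 / M"
  have a: "0 \<le> a" "a < 1"
    using M c by (auto simp: a_def)
  have contr: "norm (x - t *\<^sub>R P x) \<le> sqrt a * norm x" for x
  proof -
    have "(norm (x - t *\<^sub>R P x))\<^sup>2 = (norm x)\<^sup>2 - 2 * t * inner (P x) x + t\<^sup>2 * (norm (P x))\<^sup>2"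
      unfolding power2_norm_eq_inner
      by (simp add: inner_simps inner_commute power2_eq_square algebra_simps)
    also have "\<dots> \<le> (norm x)\<^sup>2 - 2 * t * (c\<^sup>2 * (norm x)\<^sup>2) + t\<^sup>2 * (M * (norm x)\<^sup>2)"
    proof (intro add_mono diff_mono mult_left_mono order_refl)
      show "(norm (P x))\<^sup>2 \<le> M * (norm x)\<^sup>2"
        using P_upper[of x] mult_right_mono[OF M(2), of "(norm x)\<^sup>2"] by simp
    qed (use t P_lower in auto)
    also have "\<dots> = a * (norm x)\<^sup>2"
      using M(1) by (simp add: a_def t_def power2_eq_square power4_eq_xxxx field_simps)
    finally have "norm (x - t *\<^sub>R P x) \<le> sqrt (a * (norm x)\<^sup>2)"
      by (rule real_le_rsqrt)
    then show ?thesis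
      by (simp add: real_sqrt_mult)
  qed
  have "\<exists>x. y = N x" for y
  proof -
    have "dist (x - t *\<^sub>R (P x - y)) (x' - t *\<^sub>R (P x' - y)) \<le> sqrt a * dist x x'" for x x'
      using contr[of "x - x'"] by (simp add: dist_norm P_diff algebra_simps)
    then obtain x where "x - t *\<^sub>R (P x - y) = x"
      by (rule contraction_fixpoint[rotated 2]) (use a in auto)
    then have "P x = y"
      using t by simp
    then show ?thesis
      using comm[of x] unfolding P_def by metis
  qed
  then show ?thesis
    by (auto simp: surj_def)
qed

section \<open>Invariant and reducing subspaces\<close>

lemma bounded_clinear_image_closure:
  assumes A: "bounded_clinear A" and "A ` L \<subseteq> L"
  shows "A ` closure L \<subseteq> closure L"
proof (rule image_closure_subset[OF _ closed_closure])
  show "continuous_on (closure L) A"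
    by (rule linear_continuous_on[OF bounded_clinear_bounded_linear[OF A]])
  show "A ` L \<subseteq> closure L"
    using \<open>A ` L \<subseteq> L\<close> closure_subset by (rule order_trans)
qed

lemma csubspace_closure:
  fixes L :: "'a::chilbert_space set"
  assumes "csubspace L"
  shows "csubspace (closure L)"
proof -
  have L: "0 \<in> L" "\<And>x y. x \<in> L \<Longrightarrow> y \<in> L \<Longrightarrow> x + y \<in> L" "\<And>c x. x \<in> L \<Longrightarrow> c *\<^sub>C x \<in> L"
    using assms by (auto simp: csubspace_def subspace_def)
  have zero: "0 \<in> closure L"
    by (rule subsetD[OF closure_subset L(1)])
  have add: "x + y \<in> closure L" if xy: "x \<in> closure L" "y \<in> closure L" for x y
  proof -
    obtain X Y where X: "\<forall>n. X n \<in> L" "X \<longlonglongrightarrow> x" and Y: "\<forall>n. Y n \<in> L" "Y \<longlonglongrightarrow> y"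
      using xy by (metis closure_sequential)
    have "\<forall>n. X n + Y n \<in> L"
      using X(1) Y(1) L(2) by simp
    with tendsto_add[OF X(2) Y(2)] show ?thesis
      unfolding closure_sequential by (intro exI[of _ "\<lambda>n. X n + Y n"] conjI)
  qed
  have scaleC: "c *\<^sub>C x \<in> closure L" if x: "x \<in> closure L" for c x
  proof -
    have "bounded_clinear (\<lambda>x::'a. c *\<^sub>C x)"
      by (rule bounded_clinearI[where K = "cmod c"])
        (simp_all add: scaleC_add_right scaleC_scaleC norm_scaleC mult.commute)
    then have "(\<lambda>x. c *\<^sub>C x) ` closure L \<subseteq> closure L"
      by (rule bounded_clinear_image_closure) (use L(3) in auto)
    then show ?thesis
      using x by blast
  qed
  show ?thesis
    using zero add scaleC by (simp add: csubspace_def subspace_def scaleR_scaleC)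
qed

text \<open>Invariance of \<open>M\<close> under the adjoint makes its orthogonal complement
  invariant under \<open>A\<close>.\<close>

lemma reducesI:
  assumes A: "bounded_clinear A" and "A ` M \<subseteq> M" "cadjoint A ` M \<subseteq> M"
  shows "reduces M A"
  using assms by (auto simp: reduces_def corthogonal_def cinner_cadjoint[OF A])

text \<open>Transfers reduction from \<open>N - z\<close>, where the orbits are built, to
  \<open>N\<close>, for which minimality is stated.\<close>

lemma reduces_shift:
  assumes "csubspace M" "reduces M (\<lambda>x. A x - z *\<^sub>C x)"
  shows "reduces M A"
proof -
  have "A x \<in> L" if L: "csubspace L" and img: "(\<lambda>x. A x - z *\<^sub>C x) ` L \<subseteq> L" and x: "x \<in> L" for L x
  proof -
    have "A x - z *\<^sub>C x \<in> L" "z *\<^sub>C x \<in> L"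
      using L img x by (auto simp: csubspace_def)
    then have "(A x - z *\<^sub>C x) + z *\<^sub>C x \<in> L"
      using L unfolding csubspace_def by (meson subspace_add)
    then show ?thesis
      by simp
  qed
  moreover have "csubspace (corthogonal M)"
    by (auto simp: csubspace_def corthogonal_def subspace_def cinner_add_left cinner_scaleC_left
        scaleR_scaleC)
  ultimately show ?thesis
    using assms unfolding reduces_def by (simp add: image_subset_iff)
qed

lemma spectrum_minimal_normal_extension:
  assumes S: "bounded_clinear S" and min: "minimal_normal_extension J S N"
  shows "spectrum N \<subseteq> spectrum S"
proof -
  have J: "bounded_clinear J" and nJ: "\<And>x. norm (J x) = norm x"
    and JS: "\<And>x. N (J x) = J (S x)" and normal0: "normal_op N" and N: "bounded_clinear N"
    using min by (auto simp: minimal_normal_extension_def normal_extension_def op_extends_def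
        isometric_embedding_def normal_op_def)
  have "z \<in> resolvent_set N" if z: "z \<in> resolvent_set S" for z
  proof -
    define A where "A x = N x - z *\<^sub>C x" for x
    have normal: "normal_op A"
      unfolding A_def by (rule normal_op_shift[OF normal0])
    then have A: "bounded_clinear A" and comm: "\<And>x. cadjoint A (A x) = A (cadjoint A x)"
      by (auto simp: normal_op_def fun_eq_iff)
    note A' = bounded_clinear_cadjoint[OF A]
    obtain K where K: "K > 0" "\<And>x. norm (A x) \<le> K * norm x"
      using bounded_clinear_pos_bounded[OF A] by blast
    obtain B where B: "bounded_clinear B" and right: "\<And>y. S (B y) - z *\<^sub>C B y = y"
      using z unfolding resolvent_set_def by (auto simp: fun_eq_iff)
    obtain q where q: "q > 0" "\<And>y. norm (B y) \<le> q * norm y"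
      using bounded_clinear_pos_bounded[OF B] by blast
    \<comment> \<open>The rate \<open>q\<close> is common to all orbits while \<open>C\<close> may
      vary: the initial vectors thus form a subspace, and the resulting lower bound is uniform on
      it.\<close>
    define orbit where "orbit f \<longleftrightarrow> (\<forall>n. A (f (Suc n)) = f n) \<and> (\<exists>C. \<forall>n. norm (f n) \<le> C * q ^ n)" for f
    define L where "L = {f 0 | f. orbit f}"
    \<comment> \<open>Bounded maps commuting with \<open>A\<close> send orbits to orbits. This
      serves scalars, \<open>A\<close> itself and, by normality, the adjoint of
      \<open>A\<close>.\<close>
    have orbit_map: "orbit (\<lambda>n. D (f n))"
      if f: "orbit f" and D: "\<And>x. norm (D x) \<le> k * norm x" "k \<ge> 0" "\<And>x. A (D x) = D (A x)" for f D k
    proof -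
      obtain C where C: "\<And>n. norm (f n) \<le> C * q ^ n"
        using f by (auto simp: orbit_def)
      have "norm (D (f n)) \<le> (k * C) * q ^ n" for n
        using order_trans[OF D(1) mult_left_mono[OF C D(2)]] by (simp add: mult.assoc)
      then show ?thesis
        using f D(3) unfolding orbit_def by auto
    qed
    have orbit_add: "orbit (\<lambda>n. f n + g n)" if f: "orbit f" and g: "orbit g" for f g
    proof -
      obtain C C' where C: "\<And>n. norm (f n) \<le> C * q ^ n" "\<And>n. norm (g n) \<le> C' * q ^ n"
        using f g unfolding orbit_def by blast
      have "norm (f n + g n) \<le> (C + C') * q ^ n" for n
        using norm_triangle_le[OF add_mono[OF C(1)[of n] C(2)[of n]]] by (simp add: distrib_right)
      then show ?thesis
        using f g unfolding orbit_def by (auto simp: bounded_clinear_add[OF A])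
    qed
    have L_image: "D x \<in> L"
      if x: "x \<in> L" and D: "\<And>x. norm (D x) \<le> k * norm x" "k \<ge> 0" "\<And>x. A (D x) = D (A x)" for x D k
    proof -
      obtain f where f: "x = f 0" "orbit f"
        using x by (auto simp: L_def)
      have "orbit (\<lambda>n. D (f n))"
        using orbit_map[where D = D, OF f(2)] D by blast
      then show ?thesis
        unfolding L_def f(1) by (auto intro!: exI[of _ "\<lambda>n. D (f n)"])
    qed
    have L_scaleC: "c *\<^sub>C x \<in> L" if "x \<in> L" for c x
      by (rule L_image[OF that, of _ "cmod c"]) (simp_all add: norm_scaleC bounded_clinear_scaleC[OF A])
    have L_add: "x + y \<in> L" if x: "x \<in> L" and y: "y \<in> L" for x y
    proof -
      obtain f g where "x = f 0" "y = g 0" "orbit f" "orbit g"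
        using x y by (auto simp: L_def)
      then show ?thesis
        unfolding L_def using orbit_add[of f g] by (auto intro!: exI[of _ "\<lambda>n. f n + g n"])
    qed
    have J_L: "J h \<in> L" for h
    proof -
      \<comment> \<open>On the range of \<open>J\<close> the inverse of \<open>S - z\<close>
        supplies the backward step, with growth rate \<open>q\<close>.\<close>
      have step: "A (J (B y)) = J y" for y
        using right[of y] by (metis A_def JS bounded_clinear_diff[OF J] bounded_clinear_scaleC[OF J])
      have "norm (J ((B ^^ n) h)) \<le> norm h * q ^ n" for n
      proof (induction n)
        case (Suc n)
        have "norm (B ((B ^^ n) h)) \<le> q * norm ((B ^^ n) h)"
          by (rule q(2))
        also have "\<dots> \<le> q * (norm h * q ^ n)"
          using Suc q(1) by (simp add: nJ)
        finally show ?case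
          by (simp add: nJ mult.left_commute)
      qed (simp add: nJ)
      then have "orbit (\<lambda>n. J ((B ^^ n) h))"
        unfolding orbit_def by (auto simp: step)
      then show ?thesis
        unfolding L_def by (auto intro!: exI[of _ "\<lambda>n. J ((B ^^ n) h)"])
    qed
    have csub: "csubspace L"
      unfolding csubspace_def subspace_def
      using L_add L_scaleC J_L[of 0] by (simp add: bounded_clinear_zero[OF J] scaleR_scaleC)
    have "A ` L \<subseteq> L"
      using L_image[of _ A K] K by auto
    moreover have "cadjoint A ` L \<subseteq> L"
      using L_image[of _ "cadjoint A" K] K comm by (auto simp: norm_cadjoint_normal[OF normal])
    ultimately have "reduces (closure L) A"
      by (intro reducesI[OF A] bounded_clinear_image_closure[OF A] bounded_clinear_image_closure[OF A'])
    then have "reduces (closure L) N"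
      unfolding A_def by (rule reduces_shift[OF csubspace_closure[OF csub]])
    moreover have "range J \<subseteq> closure L"
      using J_L closure_subset by blast
    ultimately have dense: "closure L = UNIV"
      using min csubspace_closure[OF csub] unfolding minimal_normal_extension_def by blast
    have contA: "continuous_on UNIV A"
      by (rule linear_continuous_on[OF bounded_clinear_bounded_linear[OF A]])
    \<comment> \<open>The lower bound is a closed condition with one constant, so it extends from
      \<open>L\<close> to its closure, the whole space.\<close>
    have "closed {x. norm x \<le> q * norm (A x)}"
      by (intro closed_Collect_le continuous_intros contA)
    moreover have "L \<subseteq> {x. norm x \<le> q * norm (A x)}"
      using normal_backward_orbit_bound[OF normal _ _ q(1)] by (auto simp: L_def orbit_def)
    ultimately have "closure L \<subseteq> {x. norm x \<le> q * norm (A x)}"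
      by (rule closure_minimal[rotated])
    then have "norm x \<le> q * norm (A x)" for x
      using dense by blast
    then have below: "inverse q * norm x \<le> norm (A x)" for x
      using q(1) by (simp add: field_simps)
    have "surj A"
      by (rule normal_bounded_below_surj[OF normal _ below]) (use q(1) in simp)
    then show ?thesis
      using below q(1) unfolding resolvent_set_iff[OF N] A_def
      by (intro conjI exI[of _ "inverse q"]) auto
  qed
  then show ?thesis
    by (auto simp: spectrum_def)
qed

section \<open>Brownian-type operators\<close>

lemma spectrum_brownian_type:
  assumes "brownian_type V E S" "normal_extension J S N"
  shows "spectrum (block_op V E (\<lambda>_. 0) S) = spectrum V \<union> spectrum S"
  using assms resolvent_set_block_upper[of V E S J N] by (auto simp: brownian_type_def spectrum_def)

text \<open>Puts the two matrices in the form required by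
  \<open>component_resolvent_extension\<close>.\<close>

lemma op_extends_block_op:
  assumes "entrywise_extension J1 J2 A11 A12 A21 A22 B11 B12 B21 B22"
  shows "op_extends (map_prod J1 J2) (block_op A11 A12 A21 A22) (block_op B11 B12 B21 B22)"
proof -
  have J: "bounded_clinear J1" "bounded_clinear J2" "\<And>x. norm (J1 x) = norm x" "\<And>x. norm (J2 x) = norm x"
    using assms by (auto simp: entrywise_extension_def isometric_embedding_def)
  have norm: "norm (map_prod J1 J2 p) = norm p" for p
    by (cases p) (simp add: norm_Pair J)
  have "bounded_clinear (map_prod J1 J2)"
    by (rule bounded_clinearI[where K = 1])
      (auto simp: norm scaleC_prod_def bounded_clinear_add[OF J(1)] bounded_clinear_add[OF J(2)]
        bounded_clinear_scaleC[OF J(1)] bounded_clinear_scaleC[OF J(2)])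
  then show ?thesis
    using assms by (auto simp: op_extends_def isometric_embedding_def norm block_op_def
        entrywise_extension_def bounded_clinear_add[OF J(1)] bounded_clinear_add[OF J(2)])
qed

theorem theorem2p4:
  fixes V :: "'h1::chilbert_space \<Rightarrow> 'h1"
    and E :: "'h2::chilbert_space \<Rightarrow> 'h1"
    and S :: "'h2 \<Rightarrow> 'h2"
    and V' :: "'k1::chilbert_space \<Rightarrow> 'k1"
    and E' :: "'k2::chilbert_space \<Rightarrow> 'k1"
    and N :: "'k2 \<Rightarrow> 'k2"
    and J1 :: "'h1 \<Rightarrow> 'k1"
    and J2 :: "'h2 \<Rightarrow> 'k2"
    and T :: "'h1 \<times> 'h2 \<Rightarrow> 'h1 \<times> 'h2"
    and R :: "'k1 \<times> 'k2 \<Rightarrow> 'k1 \<times> 'k2"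
  assumes T: "T = block_op V E (\<lambda>_. 0) S"
    and T_class: "brownian_subnormal TYPE('m::chilbert_space) V E S"
    and R: "R = block_op V' E' (\<lambda>_. 0) N"
    and R_class: "brownian_normal V' E' N"
    and ext: "entrywise_extension J1 J2 V E (\<lambda>_. 0) S V' E' (\<lambda>_. 0) N"
    and abs_ext: "op_extends J2 (op_abs E) (op_abs E')"
    and min: "minimal_normal_extension J2 S N"
  shows "(E \<noteq> (\<lambda>_. 0) \<longrightarrow>
            spectrum T = cball 0 1 \<union> spectrum S \<and> spectrum R = cball 0 1 \<union> spectrum N)
       \<and> (\<not> unitary_op V \<longrightarrow> spectrum R \<subseteq> spectrum T)
       \<and> (\<forall>\<Omega>. \<Omega> \<in> components (resolvent_set R) \<and> \<Omega> \<inter> spectrum T \<noteq> {}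
            \<longrightarrow> \<Omega> \<subseteq> spectrum T)"
proof (intro conjI impI allI; (elim conjE)?)
  have btT: "brownian_type V E S" and btR: "brownian_type V' E' N" and normal: "normal_op N"
    using T_class R_class by (auto simp: brownian_subnormal_def brownian_normal_def)
  have V: "bounded_clinear V" "cadjoint V \<circ> V = id" and V': "bounded_clinear V'" "cadjoint V' \<circ> V' = id"
    and S: "bounded_clinear S" and N: "bounded_clinear N"
    and E: "bounded_clinear E" and E': "bounded_clinear E'"
    using btT btR by (auto simp: brownian_type_def)
  have neS: "normal_extension J2 S N"
    using min by (simp add: minimal_normal_extension_def)
  \<comment> \<open>A normal operator is its own normal extension, so the triangular spectrum
    formula applies to \<open>R\<close> too.\<close>
  have neN: "normal_extension (\<lambda>x. x) N N"
    using normal by (simp add: normal_extension_def op_extends_def isometric_embedding_id)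
  have specT: "spectrum T = spectrum V \<union> spectrum S"
    unfolding T by (rule spectrum_brownian_type[OF btT neS])
  have specR: "spectrum R = spectrum V' \<union> spectrum N"
    unfolding R by (rule spectrum_brownian_type[OF btR neN])
  {
    assume "E \<noteq> (\<lambda>_. 0)"
    then obtain h where h: "E h \<noteq> 0"
      by auto
    have J1: "norm (J1 x) = norm x" and E'J2: "E' (J2 h) = J1 (E h)" for x
      using ext by (auto simp: entrywise_extension_def isometric_embedding_def)
    \<comment> \<open>The extended corner is nonzero because it extends \<open>E\<close>
      isometrically; hence \<open>V'\<close> is not unitary.\<close>
    have "E' (J2 h) \<noteq> 0"
      using h J1[of "E h"] by (auto simp: E'J2)
    then have "\<not> unitary_op V'"
      using brownian_type_unitary_corner[OF btR] by auto
    then show "spectrum R = cball 0 1 \<union> spectrum N"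
      using specR spectrum_nonunitary_isometry[OF V'] by simp
    have "\<not> unitary_op V"
      using brownian_type_unitary_corner[OF btT] h by auto
    then show "spectrum T = cball 0 1 \<union> spectrum S"
      using specT spectrum_nonunitary_isometry[OF V] by simp
  }
  {
    assume "\<not> unitary_op V"
    \<comment> \<open>Here \<open>V'\<close> may be unitary, so its spectrum is only placed inside
      the disc, which is all of \<open>spectrum V\<close>.\<close>
    then show "spectrum R \<subseteq> spectrum T"
      using specT specR spectrum_nonunitary_isometry[OF V] spectrum_isometry_subset[OF V']
        spectrum_minimal_normal_extension[OF S min] by blast
  }
  fix \<Omega>
  assume \<Omega>: "\<Omega> \<in> components (resolvent_set R)" "\<Omega> \<inter> spectrum T \<noteq> {}"
  have "op_extends (map_prod J1 J2) T R"
    unfolding T R by (rule op_extends_block_op[OF ext])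
  then show "\<Omega> \<subseteq> spectrum T"
    using component_resolvent_extension[OF _ _ _ \<Omega>] bounded_clinear_block_upper[OF V(1) E S]
      bounded_clinear_block_upper[OF V'(1) E' N] unfolding T R by blast
qed

end
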